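(* Let $F$ be a free group with finite basis $\{a_1,\dots,a_m\}$ and let $\phi$ be an automorphism of $F$ that is positive with respect to this basis. There exists a positive integer $k$ such that $\phi_0:=\phi^k$ has the following properties, where $x,y$ denote letters of the basis and supports, strata and exponential letters are those of $\phi_0$: 1. Each letter $x$ appears in its own image under $\phi_0$. 2. Each exponential letter $x$ appears at least $3$ times in its own image under $\phi_0$. 3. For all $x$, each letter $y\in\mathrm{Supp}(x)$ appears in $\phi_0(x)$. 4. For all $x$ and all $j\ge1$, the leftmost and rightmost letters of $\phi_0^j(x)$ are the same as those of $\phi_0(x)$. 5. For all $x$, all $j\ge1$ and all strata $\Sigma\subseteq\mathrm{Supp}(x)$, the leftmost (respectively, rightmost) letter from $\Sigma$ in the reduced word $\phi_0^j(x)$ is the same as the leftmost (respectively, rightmost) letter from $\Sigma$ in $\phi_0(x)$.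
   Context: $\phi$ is positive with respect to the basis if the reduced words $\phi(a_i)$ contain no inverse letters $a_j^{-1}$. For a positive automorphism $\psi$ and a basis letter $x$: $\mathrm{Supp}(x)$ is the set of all letters which appear in the reduced word $\psi^j(x)$ for some $j\ge0$; the stratum of $x$ is $\Sigma(x)=\{y\in\mathrm{Supp}(x):\mathrm{Supp}(y)=\mathrm{Supp}(x)\}$. The stratum $\Sigma(x)$ is parabolic if $x\notin\mathrm{Supp}(y)$ for all $y\in\mathrm{Supp}(x)\smallsetminus\{x\}$, and exponential if $\Sigma(x)=\Sigma(y)$ for some $y\ne x$; the letter $x$ is called exponential if $\Sigma(x)$ is exponential. *)

theory Defs
  imports "HOL-Algebra.Group"
begin

text \<open>
  A word is a list of signed letters; \<open>(a, True)\<close> stands for the basis letter \<open>a\<close> and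
  \<open>(a, False)\<close> for the inverse letter.
\<close>

type_synonym 'a word = "('a \<times> bool) list"

definition reduced_words :: "'a set \<Rightarrow> 'a word set" where
  "reduced_words A =
     {w. fst ` set w \<subseteq> A \<and> successively (\<lambda>l l'. \<not> (fst l = fst l' \<and> snd l \<noteq> snd l')) w}"

definition letter_value :: "('a, 'b) monoid_scheme \<Rightarrow> 'a \<times> bool \<Rightarrow> 'a" where
  "letter_value F l = (if snd l then fst l else inv\<^bsub>F\<^esub> (fst l))"

definition word_value :: "('a, 'b) monoid_scheme \<Rightarrow> 'a word \<Rightarrow> 'a" where
  "word_value F w = foldr (\<lambda>l g. letter_value F l \<otimes>\<^bsub>F\<^esub> g) w \<one>\<^bsub>F\<^esub>"

text \<open>\<open>F\<close> is free with basis \<open>A\<close>: every element is the value of exactly one reduced word over \<open>A\<close>.\<close>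

locale free_group = group F for F :: "('a, 'b) monoid_scheme" (structure) +
  fixes A :: "'a set"
  assumes basis_subset: "A \<subseteq> carrier F"
    and bij_betw_reduced_words: "bij_betw (word_value F) (reduced_words A) (carrier F)"

definition reduced_word :: "('a, 'b) monoid_scheme \<Rightarrow> 'a set \<Rightarrow> 'a \<Rightarrow> 'a word" where
  "reduced_word F A g = the_inv_into (reduced_words A) (word_value F) g"

definition positive :: "('a, 'b) monoid_scheme \<Rightarrow> 'a set \<Rightarrow> ('a \<Rightarrow> 'a) \<Rightarrow> bool" where
  "positive F A \<psi> \<longleftrightarrow> (\<forall>a\<in>A. \<forall>b\<in>A. (b, False) \<notin> set (reduced_word F A (\<psi> a)))"

text \<open>
  The notions below are meant for positive automorphisms, all of whose iterates map letters to
  words without inverse letters; hence only occurrences of \<open>(y, True)\<close> are considered.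
\<close>

definition occurrences :: "('a, 'b) monoid_scheme \<Rightarrow> 'a set \<Rightarrow> 'a \<Rightarrow> 'a \<Rightarrow> nat" where
  "occurrences F A y g = count_list (reduced_word F A g) (y, True)"

definition appears_in :: "('a, 'b) monoid_scheme \<Rightarrow> 'a set \<Rightarrow> 'a \<Rightarrow> 'a \<Rightarrow> bool" where
  "appears_in F A y g \<longleftrightarrow> (y, True) \<in> set (reduced_word F A g)"

definition Supp :: "('a, 'b) monoid_scheme \<Rightarrow> 'a set \<Rightarrow> ('a \<Rightarrow> 'a) \<Rightarrow> 'a \<Rightarrow> 'a set" where
  "Supp F A \<psi> x = {y \<in> A. \<exists>j. appears_in F A y ((\<psi> ^^ j) x)}"

definition stratum :: "('a, 'b) monoid_scheme \<Rightarrow> 'a set \<Rightarrow> ('a \<Rightarrow> 'a) \<Rightarrow> 'a \<Rightarrow> 'a set" where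
  "stratum F A \<psi> x = {y \<in> Supp F A \<psi> x. Supp F A \<psi> y = Supp F A \<psi> x}"

definition exponential :: "('a, 'b) monoid_scheme \<Rightarrow> 'a set \<Rightarrow> ('a \<Rightarrow> 'a) \<Rightarrow> 'a \<Rightarrow> bool" where
  "exponential F A \<psi> x \<longleftrightarrow> (\<exists>y\<in>A. y \<noteq> x \<and> stratum F A \<psi> x = stratum F A \<psi> y)"

text \<open>The value is \<open>None\<close> if the word contains no letter from \<open>S\<close>.\<close>

definition leftmost_in :: "'a set \<Rightarrow> 'a word \<Rightarrow> ('a \<times> bool) option" where
  "leftmost_in S w = find (\<lambda>l. l \<in> S \<times> {True}) w"

definition rightmost_in :: "'a set \<Rightarrow> 'a word \<Rightarrow> ('a \<times> bool) option" where
  "rightmost_in S w = find (\<lambda>l. l \<in> S \<times> {True}) (rev w)"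

end

theory Submission
  imports Defs
begin

text \<open>
  A positive automorphism acts on basis letters as a substitution \<open>f\<close> of positive words.

  Every letter \<open>x\<close> occurs in some \<open>f\<^sup>j(x)\<close> with \<open>j > 0\<close>: otherwise \<open>\<phi>\<close> would map all letters of
  \<open>Supp(x)\<close> to words in the smaller alphabet \<open>Supp(x) - {x}\<close>.  This is impossible because
  \<open>h \<mapsto> h \<circ> \<phi>\<close> permutes the homomorphisms to \<open>Z/2\<close>: the restrictions of \<open>h \<circ> \<phi>\<close> to the \<open>n\<close> letters of
  \<open>Supp(x)\<close> attain all \<open>2\<^sup>n\<close> possibilities, but would depend on only \<open>n - 1\<close> values of \<open>h\<close>.

  The list of the distinct letters of \<open>f\<^sup>n(x)\<close> in the order of their first (last) occurrences
  determines the same list for \<open>f\<^sup>n\<^sup>+\<^sup>1(x)\<close> and takes finitely many values.  Hence some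
  \<open>q > 0\<close> makes it constant along the positive multiples of \<open>q\<close>.  This list determines the set of
  letters and the leftmost (rightmost) letter from any set.  Finally, if \<open>x \<noteq> y\<close> both occur in
  \<open>f\<^sup>q(x)\<close> and in \<open>f\<^sup>q(y)\<close>, then \<open>x\<close> occurs at least three times in \<open>f\<^sup>3\<^sup>q(x)\<close>, so \<open>k = 3q\<close> works.
\<close>

section \<open>Iterated substitutions\<close>

primrec subst_pow :: "('a \<Rightarrow> 'a list) \<Rightarrow> nat \<Rightarrow> 'a \<Rightarrow> 'a list" where
  "subst_pow f 0 x = [x]"
| "subst_pow f (Suc n) x = concat (map f (subst_pow f n x))"

lemma subst_pow_add:
  "subst_pow f (m + n) x = concat (map (subst_pow f m) (subst_pow f n x))"
proof (induction m)
  case 0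
  show ?case by (induction "subst_pow f n x") auto
next
  case (Suc m)
  have "concat (map f (concat (map g w))) = concat (map (\<lambda>y. concat (map f (g y))) w)" for g w
    by (induction w) auto
  with Suc show ?case by simp
qed

lemma subst_pow_trans:
  "y \<in> set (subst_pow f n x) \<Longrightarrow> z \<in> set (subst_pow f m y) \<Longrightarrow> z \<in> set (subst_pow f (m + n) x)"
  by (auto simp: subst_pow_add)

lemma subst_pow_recurrent:
  assumes "x \<in> set (subst_pow f j x)"
  shows "x \<in> set (subst_pow f (j * i) x)"
proof (induction i)
  case (Suc i)
  from subst_pow_trans[OF this assms] show ?case by simp
qed simp

lemma subst_pow_closed:
  assumes "\<And>a. a \<in> A \<Longrightarrow> set (f a) \<subseteq> A" and "x \<in> A"
  shows "set (subst_pow f n x) \<subseteq> A"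
  by (induction n) (use assms in auto)

section \<open>Orders of first and last occurrences\<close>

lemma remdups_concat_map:
  fixes f :: "'a \<Rightarrow> 'b list"
  shows "remdups (concat (map f (remdups w))) = remdups (concat (map f w))"
proof (induction w)
  case (Cons a w)
  have append: "remdups (u @ v) = filter (\<lambda>y. y \<notin> set v) (remdups u) @ remdups v" for u v :: "'b list"
    by (induction u) auto
  show ?case
  proof (cases "a \<in> set w")
    case True
    \<comment> \<open>\<open>remdups\<close> keeps last occurrences. If \<open>a\<close> recurs in
      \<open>w\<close>, all letters of \<open>f a\<close> recur later in the image, so this copy of
      \<open>f a\<close> leaves no trace.\<close>
    then have "set (f a) \<subseteq> set (concat (map f w))" by auto
    then have "filter (\<lambda>y. y \<notin> set (concat (map f w))) (remdups (f a)) = []"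
      by (auto simp: filter_empty_conv)
    with True Cons append[of "f a" "concat (map f w)"] show ?thesis by simp
  next
    case False
    with Cons show ?thesis by (simp add: append)
  qed
qed simp

text \<open>Since \<open>remdups\<close> retains the last copy of each letter, in order, the last
  letter satisfying \<open>P\<close> survives.\<close>

lemma find_rev_remdups: "find P (rev (remdups w)) = find P (rev w)"
proof (induction w)
  case (Cons a w)
  have append: "find P (u @ v) = (case find P u of None \<Rightarrow> find P v | Some y \<Rightarrow> Some y)" for u v
    by (induction u) auto
  show ?case
  proof (cases "a \<in> set w \<and> find P (rev w) = None")
    case True
    then have "\<not> P a" by (auto simp: find_None_iff)
    with True Cons show ?thesis by (simp add: append)
  next
    case False
    with Cons show ?thesis by (auto simp: append split: option.splits)
  qed
qed simp

text \<open>The two reversals in the first component make \<open>remdups\<close> keep first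
  occurrences instead of last ones.\<close>

definition first_last_orders :: "'a list \<Rightarrow> 'a list \<times> 'a list" where
  "first_last_orders w = (rev (remdups (rev w)), remdups w)"

lemma first_last_orders_eqD:
  assumes "first_last_orders v = first_last_orders w"
  shows "set v = set w" "find P v = find P w" "find P (rev v) = find P (rev w)"
proof -
  have eq: "remdups (rev v) = remdups (rev w)" "remdups v = remdups w"
    using assms by (auto simp: first_last_orders_def)
  show "set v = set w" using eq(2) by (metis set_remdups)
  show "find P v = find P w" using eq(1) by (metis find_rev_remdups rev_rev_ident)
  show "find P (rev v) = find P (rev w)" using eq(2) by (metis find_rev_remdups)
qed

lemma first_last_orders_concat_map:
  assumes "first_last_orders v = first_last_orders w"
  shows "first_last_orders (concat (map f v)) = first_last_orders (concat (map f w))"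
proof -
  have eq: "remdups (rev v) = remdups (rev w)" "remdups v = remdups w"
    using assms by (auto simp: first_last_orders_def)
  \<comment> \<open>Reversal turns the substitution \<open>f\<close> into
    \<open>rev \<circ> f\<close>, so first occurrences reduce to the result on last
    occurrences.\<close>
  have "rev (concat (map f u)) = concat (map (rev \<circ> f) (rev u))" for u
    by (simp add: rev_concat rev_map)
  then show ?thesis
    unfolding first_last_orders_def using eq remdups_concat_map[of f] remdups_concat_map[of "rev \<circ> f"]
    by metis
qed

section \<open>Eventually periodic iteration\<close>

lemma iteration_constant_on_multiples:
  fixes s :: "nat \<Rightarrow> 'b"
  assumes "finite (range s)" and step: "\<And>m n. s m = s n \<Longrightarrow> s (Suc m) = s (Suc n)"
  shows "\<exists>q>0. \<forall>m>0. s (q * m) = s q"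
proof -
  have "\<not> inj s" using assms(1) finite_imageD by blast
  then obtain i i' where "i < i'" "s i = s i'"
    by (metis injI linorder_neqE_nat)
  then obtain d where d: "d > 0" "s (i + d) = s i"
    by (metis less_imp_add_positive)
  have period: "s (i + n + d) = s (i + n)" for n
  proof (induction n)
    case (Suc n)
    then show ?case using step[of "i + n + d" "i + n"] by simp
  qed (simp add: d)
  have periods: "s (i + n + d * r) = s (i + n)" for n r
  proof (induction r)
    case (Suc r)
    then show ?case using period[of "n + d * r"] by (simp add: algebra_simps)
  qed simp
  \<comment> \<open>From index \<open>i\<close> on, \<open>s\<close> has period \<open>d\<close>.
    The number \<open>d * Suc i\<close> is a multiple of \<open>d\<close>, lies in the periodic
    range, and is positive even for \<open>i = 0\<close>.\<close>
  have "s (d * Suc i * m) = s (d * Suc i)" if "0 < m" for m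
  proof -
    obtain r where m: "m = Suc r" using gr0_implies_Suc[OF \<open>0 < m\<close>] by blast
    have "i \<le> d * Suc i" using d(1) by (cases d) auto
    then obtain n where n: "d * Suc i = i + n" using le_Suc_ex by blast
    have "d * Suc i * m = d * Suc i + d * (Suc i * r)"
      unfolding m by (simp add: algebra_simps)
    then show ?thesis using periods[of n "Suc i * r"] by (simp only: n)
  qed
  then show ?thesis using d(1) by (intro exI[of _ "d * Suc i"]) auto
qed

lemma subst_pow_orders_constant_on_multiples:
  assumes "finite A" and closed: "\<And>a. a \<in> A \<Longrightarrow> set (f a) \<subseteq> A"
  shows "\<exists>q>0. \<forall>m>0. \<forall>x\<in>A.
    first_last_orders (subst_pow f (q * m) x) = first_last_orders (subst_pow f q x)"
proof -
  \<comment> \<open>Treating all letters as one state yields a single \<open>q\<close> for all of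
    them. Restriction to \<open>A\<close> places the states in a finite extensional product.\<close>
  define s where "s n = (\<lambda>x\<in>A. first_last_orders (subst_pow f n x))" for n
  let ?D = "{w. set w \<subseteq> A \<and> distinct w}"
  have "range s \<subseteq> (\<Pi>\<^sub>E x\<in>A. ?D \<times> ?D)"
    using subst_pow_closed[of A f, OF closed] by (auto simp: s_def first_last_orders_def)
  moreover have "finite ?D"
    using finite_subset_distinct[OF \<open>finite A\<close>] by simp
  ultimately have "finite (range s)"
    using finite_PiE[OF \<open>finite A\<close>, of "\<lambda>_. ?D \<times> ?D"] by (auto intro: finite_subset)
  moreover have "s (Suc m) = s (Suc n)" if "s m = s n" for m n
  proof -
    have eq: "first_last_orders (subst_pow f m x) = first_last_orders (subst_pow f n x)" if "x \<in> A" for x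
      using fun_cong[OF \<open>s m = s n\<close>, of x] that by (simp add: s_def)
    show ?thesis
      unfolding s_def by (rule restrict_ext) (simp add: first_last_orders_concat_map[OF eq])
  qed
  ultimately obtain q where q: "q > 0" "\<And>m. m > 0 \<Longrightarrow> s (q * m) = s q"
    using iteration_constant_on_multiples[of s] by blast
  have "first_last_orders (subst_pow f (q * m) x) = first_last_orders (subst_pow f q x)"
    if "m > 0" "x \<in> A" for m x
    using fun_cong[OF q(2)[OF that(1)], of x] that(2) by (simp add: s_def)
  with q(1) show ?thesis by blast
qed

section \<open>Counting occurrences in iterates\<close>

lemma sum_list_map_ge_two:
  fixes h :: "'a \<Rightarrow> nat"
  assumes "x \<in> set w" "y \<in> set w" "x \<noteq> y"
  shows "h x + h y \<le> sum_list (map h w)"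
proof -
  have "sum_list (map h w) = h x + (h y + sum_list (map h (remove1 y (remove1 x w))))"
    using assms by (metis in_set_remove1 sum_list_map_remove1)
  then show ?thesis by simp
qed

lemma count_list_concat_map:
  "count_list (concat (map g w)) x = sum_list (map (\<lambda>y. count_list (g y) x) w)"
  by (induction w) auto

lemma count_subst_pow_ge_3:
  assumes "x \<noteq> y" "{x, y} \<subseteq> set (subst_pow f q x)" "{x, y} \<subseteq> set (subst_pow f q y)"
  shows "3 \<le> count_list (subst_pow f (3 * q) x) x"
proof -
  have pos: "1 \<le> count_list w x" if "x \<in> set w" for w
    using that count_list_0_iff[of w x] by linarith
  \<comment> \<open>The \<open>q\<close>-th iterates of \<open>x\<close> and of \<open>y\<close>
    each contribute an occurrence of \<open>x\<close>. One more round of \<open>q\<close> steps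
    doubles this to at least four.\<close>
  have two: "2 \<le> count_list (subst_pow f (q + q) z) x" if "{x, y} \<subseteq> set (subst_pow f q z)" for z
    using sum_list_map_ge_two[of x "subst_pow f q z" y "\<lambda>u. count_list (subst_pow f q u) x"]
      that assms pos[of "subst_pow f q x"] pos[of "subst_pow f q y"]
    by (simp add: subst_pow_add count_list_concat_map)
  have "subst_pow f (3 * q) x = concat (map (subst_pow f (q + q)) (subst_pow f q x))"
    using subst_pow_add[of f "q + q" q x] by (simp add: mult.commute[of 3] numeral_3_eq_3 add.assoc)
  then show ?thesis
    using sum_list_map_ge_two[of x "subst_pow f q x" y "\<lambda>u. count_list (subst_pow f (q + q) u) x"]
      assms two[of x] two[of y]
    by (simp add: count_list_concat_map)
qed

section \<open>Words in a free group\<close>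

text \<open>This is the homomorphism to Z/2 that sends the letters in \<open>B\<close> to 1 and the
  others to 0. Signs are ignored because an element of Z/2 is its own inverse.\<close>

definition letter_parity :: "'a set \<Rightarrow> 'a word \<Rightarrow> bool" where
  "letter_parity B w \<longleftrightarrow> odd (length (filter (\<lambda>l. fst l \<in> B) w))"

lemma letter_parity_simps [simp]:
  "\<not> letter_parity B []"
  "letter_parity B (l # w) \<longleftrightarrow> (fst l \<in> B) \<noteq> letter_parity B w"
  "letter_parity B (u @ w) \<longleftrightarrow> letter_parity B u \<noteq> letter_parity B w"
  by (auto simp: letter_parity_def)

lemma letter_parity_cong:
  assumes "\<And>l. l \<in> set w \<Longrightarrow> fst l \<in> B \<longleftrightarrow> fst l \<in> C"
  shows "letter_parity B w = letter_parity C w"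
  using assms by (induction w) auto

lemma word_value_Nil [simp]: "word_value F [] = \<one>\<^bsub>F\<^esub>"
  by (simp add: word_value_def)

lemma word_value_Cons [simp]: "word_value F (l # w) = letter_value F l \<otimes>\<^bsub>F\<^esub> word_value F w"
  by (simp add: word_value_def)

abbreviation positive_word :: "'a list \<Rightarrow> 'a word" where
  "positive_word w \<equiv> map (\<lambda>a. (a, True)) w"

lemma leftmost_in_positive_word:
  "leftmost_in S (positive_word w) = map_option (\<lambda>a. (a, True)) (find (\<lambda>a. a \<in> S) w)"
  unfolding leftmost_in_def by (induction w) auto

lemma rightmost_in_positive_word:
  "rightmost_in S (positive_word w) = map_option (\<lambda>a. (a, True)) (find (\<lambda>a. a \<in> S) (rev w))"
  using leftmost_in_positive_word[of S "rev w"]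
  by (simp add: leftmost_in_def rightmost_in_def rev_map)

lemma count_list_positive_word: "count_list (positive_word w) (y, True) = count_list w y"
  by (induction w) auto

context free_group
begin

lemma letter_value_closed [simp]: "fst l \<in> A \<Longrightarrow> letter_value F l \<in> carrier F"
  using basis_subset by (auto simp: letter_value_def)

lemma word_value_closed [simp]: "fst ` set w \<subseteq> A \<Longrightarrow> word_value F w \<in> carrier F"
  by (induction w) auto

lemma word_value_append:
  "fst ` set u \<subseteq> A \<Longrightarrow> fst ` set v \<subseteq> A \<Longrightarrow>
    word_value F (u @ v) = word_value F u \<otimes> word_value F v"
  by (induction u) (auto simp: m_assoc)

lemma reduced_word_in: "g \<in> carrier F \<Longrightarrow> reduced_word F A g \<in> reduced_words A"
  and word_value_reduced_word [simp]: "g \<in> carrier F \<Longrightarrow> word_value F (reduced_word F A g) = g"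
  and reduced_word_word_value: "w \<in> reduced_words A \<Longrightarrow> reduced_word F A (word_value F w) = w"
  using bij_betw_reduced_words unfolding reduced_word_def
  by (auto simp: bij_betw_def the_inv_into_into f_the_inv_into_f the_inv_into_f_f)

lemma letters_reduced_word: "g \<in> carrier F \<Longrightarrow> fst ` set (reduced_word F A g) \<subseteq> A"
  using reduced_word_in by (auto simp: reduced_words_def)

text \<open>Reducing from the right, each cancellation removes two copies of the same letter with
  opposite signs. This changes neither the value nor any parity.\<close>

lemma exists_reduction:
  assumes "fst ` set w \<subseteq> A"
  shows "\<exists>w'\<in>reduced_words A. word_value F w' = word_value F w \<and>
    (\<forall>B. letter_parity B w' = letter_parity B w)"
  using assms
proof (induction w)
  case Nil
  then show ?case by (intro bexI[of _ "[]"]) (auto simp: reduced_words_def)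
next
  case (Cons l w)
  then obtain w' where w': "w' \<in> reduced_words A" "word_value F w' = word_value F w"
    "\<And>B. letter_parity B w' = letter_parity B w" by auto
  have l: "fst l \<in> A" using Cons.prems by simp
  show ?case
  proof (cases "l # w' \<in> reduced_words A")
    case True
    then show ?thesis using w' by (intro bexI[of _ "l # w'"]) auto
  next
    case False
    \<comment> \<open>As \<open>w'\<close> is reduced, \<open>l # w'\<close> can only fail to be
      reduced at its front.\<close>
    then obtain l' v where v: "w' = l' # v" "fst l = fst l'" "snd l \<noteq> snd l'"
      using w'(1) l by (cases w') (auto simp: reduced_words_def)
    have red: "v \<in> reduced_words A"
      using w'(1) v(1) by (cases v) (auto simp: reduced_words_def)
    then have vcl: "word_value F v \<in> carrier F" by (auto simp: reduced_words_def)
    have fin: "fst l' \<in> carrier F" using l v(2) basis_subset by auto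
    have "letter_value F l \<otimes> letter_value F l' = \<one>"
      using v(2,3) fin by (auto simp: letter_value_def)
    then have "word_value F (l # w) = word_value F v"
      using w'(2) v vcl l m_assoc[of "letter_value F l" "letter_value F l'" "word_value F v"]
      by (simp flip: w'(2))
    moreover have "letter_parity B v = letter_parity B (l # w)" for B
      using v w'(3)[of B] by auto
    ultimately show ?thesis using red by (intro bexI[of _ v]) auto
  qed
qed

text \<open>This makes parity a function of the group element, computable from any word representing
  it.\<close>

lemma letter_parity_reduced_word_word_value:
  assumes "fst ` set w \<subseteq> A"
  shows "letter_parity B (reduced_word F A (word_value F w)) = letter_parity B w"
  using exists_reduction[OF assms] reduced_word_word_value by metis

section \<open>Letter parities as homomorphisms from \<open>F\<close> to Z/2\<close>

lemma letter_parity_mult: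
  assumes "g \<in> carrier F" "h \<in> carrier F"
  shows "letter_parity B (reduced_word F A (g \<otimes> h)) \<longleftrightarrow>
    letter_parity B (reduced_word F A g) \<noteq> letter_parity B (reduced_word F A h)"
  using letter_parity_reduced_word_word_value[of "reduced_word F A g @ reduced_word F A h" B]
    assms letters_reduced_word word_value_append
  by auto

lemma letter_parity_one: "\<not> letter_parity B (reduced_word F A \<one>)"
  using letter_parity_reduced_word_word_value[of "[]" B] by simp

lemma letter_parity_inv:
  assumes "g \<in> carrier F"
  shows "letter_parity B (reduced_word F A (inv g)) = letter_parity B (reduced_word F A g)"
  using letter_parity_mult[of g "inv g" B] assms letter_parity_one[of B] by simp

lemma positive_word_in_reduced_words: "set w \<subseteq> A \<Longrightarrow> positive_word w \<in> reduced_words A"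
proof (induction w)
  case (Cons a w)
  then show ?case by (cases w) (auto simp: reduced_words_def)
qed (simp add: reduced_words_def)

text \<open>The parity for \<open>C\<close> composed with \<open>\<psi>\<close> is again a
  homomorphism to Z/2, hence the parity for the set of basis letters on which it takes the value
  1.\<close>

lemma letter_parity_hom:
  assumes "\<psi> \<in> hom F F" and "fst ` set w \<subseteq> A"
  shows "letter_parity {a \<in> A. letter_parity C (reduced_word F A (\<psi> a))} w =
    letter_parity C (reduced_word F A (\<psi> (word_value F w)))"
  using assms(2)
proof (induction w)
  case Nil
  interpret group_hom F F \<psi> using assms(1) by unfold_locales
  show ?case using letter_parity_one by simp
next
  case (Cons l w)
  interpret group_hom F F \<psi> using assms(1) by unfold_locales
  have l: "fst l \<in> A" "fst l \<in> carrier F" using Cons.prems basis_subset by auto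
  have "letter_parity C (reduced_word F A (\<psi> (letter_value F l))) =
      letter_parity C (reduced_word F A (\<psi> (fst l)))"
    using l letter_parity_inv by (auto simp: letter_value_def)
  then show ?case using Cons l by (simp add: letter_parity_mult)
qed

text \<open>The parities for \<open>D\<close> of the words \<phi>(a), with a in \<open>S\<close>,
  form a pattern. Letting \<open>D\<close> range over subsets of \<open>T\<close> gives at most
  2^|T| patterns, and invertibility of \<phi> makes every subset of \<open>S\<close> occur.\<close>

lemma iso_card_le:
  assumes \<phi>: "\<phi> \<in> iso F F" and "S \<subseteq> A" and "finite T"
    and supp: "\<And>a. a \<in> S \<Longrightarrow> fst ` set (reduced_word F A (\<phi> a)) \<subseteq> T"
  shows "card S \<le> card T"
proof -
  let ?h = "\<lambda>D. {a \<in> S. letter_parity D (reduced_word F A (\<phi> a))}"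
  define \<psi> where "\<psi> = inv_into (carrier F) \<phi>"
  have bij: "bij_betw \<phi> (carrier F) (carrier F)" using \<phi> by (simp add: iso_def)
  have \<psi>: "\<psi> \<in> hom F F" using iso_set_sym[OF \<phi>] by (simp add: \<psi>_def iso_def)
  have "C \<in> ?h ` Pow T" if C: "C \<subseteq> S" for C
  proof -
    \<comment> \<open>\<open>B\<close> encodes the parity for \<open>C\<close> composed with the
      inverse of \<phi>; composing with \<phi> returns the parity for \<open>C\<close>. Cutting
      \<open>B\<close> down to \<open>T\<close> is harmless, since the words \<phi>(a) use only
      letters of \<open>T\<close>.\<close>
    define B where "B = {a \<in> A. letter_parity C (reduced_word F A (\<psi> a))}"
    have "letter_parity (B \<inter> T) (reduced_word F A (\<phi> a)) \<longleftrightarrow> a \<in> C" if a: "a \<in> S" for a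
    proof -
      have acl: "a \<in> carrier F" "a \<in> A" using a assms(2) basis_subset by auto
      then have \<phi>a: "\<phi> a \<in> carrier F" using bij by (auto simp: bij_betw_def)
      have "letter_parity (B \<inter> T) (reduced_word F A (\<phi> a)) = letter_parity B (reduced_word F A (\<phi> a))"
        by (rule letter_parity_cong) (use supp[OF a] in auto)
      also have "\<dots> = letter_parity C (reduced_word F A (\<psi> (\<phi> a)))"
        using letter_parity_hom[OF \<psi> letters_reduced_word[OF \<phi>a], of C] \<phi>a by (simp add: B_def)
      also have "\<psi> (\<phi> a) = word_value F [(a, True)]"
        using bij acl by (simp add: \<psi>_def bij_betw_inv_into_left letter_value_def)
      also have "letter_parity C (reduced_word F A \<dots>) \<longleftrightarrow> a \<in> C"
        using letter_parity_reduced_word_word_value[of "[(a, True)]" C] acl by simp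
      finally show ?thesis .
    qed
    then have "C = ?h (B \<inter> T)" using C by blast
    then show ?thesis by blast
  qed
  then have "Pow S \<subseteq> ?h ` Pow T" by blast
  then have "card (Pow S) \<le> card (Pow T)"
    using \<open>finite T\<close> by (intro surj_card_le[of "Pow T"]) auto
  moreover have "finite (Pow S)"
    using \<open>Pow S \<subseteq> ?h ` Pow T\<close> \<open>finite T\<close> by (meson finite_Pow_iff finite_imageI finite_subset)
  ultimately show ?thesis using \<open>finite T\<close> by (simp add: card_Pow)
qed

section \<open>Positive automorphisms as substitutions\<close>

text \<open>Dropping the signs loses nothing when \<phi> is positive.\<close>

definition letter_subst :: "('a \<Rightarrow> 'a) \<Rightarrow> 'a \<Rightarrow> 'a list" where
  "letter_subst \<phi> a = map fst (reduced_word F A (\<phi> a))"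

lemma letter_subst_closed:
  assumes "\<phi> \<in> hom F F" "a \<in> A"
  shows "set (letter_subst \<phi> a) \<subseteq> A"
  using assms letters_reduced_word[of "\<phi> a"] basis_subset
  by (auto simp: letter_subst_def dest: hom_in_carrier)

lemma positive_word_letter_subst:
  assumes "\<phi> \<in> hom F F" "positive F A \<phi>" "a \<in> A"
  shows "positive_word (letter_subst \<phi> a) = reduced_word F A (\<phi> a)"
proof -
  have "fst ` set (reduced_word F A (\<phi> a)) \<subseteq> A"
    using assms(1,3) basis_subset by (intro letters_reduced_word) (auto dest: hom_in_carrier)
  moreover have "(b, False) \<notin> set (reduced_word F A (\<phi> a))" if "b \<in> A" for b
    using assms(2,3) that by (auto simp: positive_def)
  ultimately have "(fst l, True) = l" if "l \<in> set (reduced_word F A (\<phi> a))" for l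
    using that by (cases l; cases "snd l") force+
  then show ?thesis by (simp add: letter_subst_def o_def map_idI)
qed

lemma word_value_concat_letter_subst:
  assumes "\<phi> \<in> hom F F" "positive F A \<phi>" "set w \<subseteq> A"
  shows "word_value F (positive_word (concat (map (letter_subst \<phi>) w))) =
    \<phi> (word_value F (positive_word w))"
  using assms(3)
proof (induction w)
  case Nil
  interpret group_hom F F \<phi> using assms(1) by unfold_locales
  show ?case by simp
next
  case (Cons a w)
  interpret group_hom F F \<phi> using assms(1) by unfold_locales
  have a: "a \<in> A" "a \<in> carrier F" using Cons.prems basis_subset by auto
  have "set (concat (map (letter_subst \<phi>) w)) \<subseteq> A"
    using Cons.prems letter_subst_closed[OF assms(1)] by auto
  then have "word_value F (positive_word (concat (map (letter_subst \<phi>) (a # w)))) =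
      word_value F (positive_word (letter_subst \<phi> a)) \<otimes>
      word_value F (positive_word (concat (map (letter_subst \<phi>) w)))"
    using letter_subst_closed[OF assms(1) a(1)]
    by (simp add: image_image word_value_append)
  also have "\<dots> = \<phi> a \<otimes> \<phi> (word_value F (positive_word w))"
    using Cons a by (simp add: positive_word_letter_subst[OF assms(1,2)])
  also have "\<dots> = \<phi> (word_value F (positive_word (a # w)))"
    using Cons.prems a by (simp add: letter_value_def image_image)
  finally show ?case .
qed

text \<open>Concatenating positive words causes no cancellation, so the substituted word is already
  reduced and uniqueness of reduced words applies.\<close>

lemma reduced_word_funpow:
  assumes "\<phi> \<in> hom F F" "positive F A \<phi>" "x \<in> A"
  shows "reduced_word F A ((\<phi> ^^ n) x) = positive_word (subst_pow (letter_subst \<phi>) n x)"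
proof -
  have closed: "set (subst_pow (letter_subst \<phi>) n x) \<subseteq> A" for n
    using subst_pow_closed letter_subst_closed assms by metis
  have "(\<phi> ^^ n) x = word_value F (positive_word (subst_pow (letter_subst \<phi>) n x))"
  proof (induction n)
    case 0
    then show ?case using assms(3) basis_subset by (auto simp: letter_value_def)
  next
    case (Suc n)
    then show ?case by (simp add: word_value_concat_letter_subst[OF assms(1,2) closed])
  qed
  then show ?thesis
    using reduced_word_word_value positive_word_in_reduced_words closed by metis
qed

lemma letter_recurrent:
  assumes "finite A" "\<phi> \<in> iso F F" "positive F A \<phi>" "x \<in> A"
  shows "\<exists>j>0. x \<in> set (subst_pow (letter_subst \<phi>) j x)"
proof (rule ccontr)
  assume not: "\<not> ?thesis"
  let ?p = "subst_pow (letter_subst \<phi>)"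
  define S where "S = (\<Union>j. set (?p j x))"
  have hom: "\<phi> \<in> hom F F" using assms(2) by (simp add: iso_def)
  have "S \<subseteq> A"
    unfolding S_def using subst_pow_closed letter_subst_closed[OF hom] assms(4) by (metis UN_least)
  then have "finite S" using assms(1) finite_subset by blast
  have "x \<in> set (?p 0 x)" by simp
  then have "x \<in> S" unfolding S_def by blast
  have "fst ` set (reduced_word F A (\<phi> a)) \<subseteq> S - {x}" if a: "a \<in> S" for a
  proof -
    obtain j where "a \<in> set (?p j x)" using a by (auto simp: S_def)
    \<comment> \<open>The exponent \<open>Suc j\<close> is positive, so by assumption
      \<open>x\<close> does not occur at that stage.\<close>
    then have sub: "set (letter_subst \<phi> a) \<subseteq> set (?p (Suc j) x)" by auto
    then have "x \<notin> set (letter_subst \<phi> a)" using not by blast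
    with sub have "set (letter_subst \<phi> a) \<subseteq> S - {x}" unfolding S_def by blast
    then show ?thesis by (simp add: letter_subst_def)
  qed
  then have "card S \<le> card (S - {x})"
    using iso_card_le[OF assms(2) \<open>S \<subseteq> A\<close>, of "S - {x}"] \<open>finite S\<close> by blast
  then show False
    using card_Diff1_less[OF \<open>finite S\<close> \<open>x \<in> S\<close>] by simp
qed

end

section \<open>The choice of \<open>k\<close> and the five properties\<close>

theorem proposition1p4p5:
  fixes F :: "('a, 'b) monoid_scheme" and A :: "'a set" and \<phi> :: "'a \<Rightarrow> 'a"
  assumes "free_group F A"
    and "finite A"
    and "\<phi> \<in> iso F F"
    and "positive F A \<phi>"
  shows "\<exists>k::nat. k > 0 \<and> (let \<phi>\<^sub>0 = \<phi> ^^ k in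
      (\<forall>x\<in>A. appears_in F A x (\<phi>\<^sub>0 x)) \<and>
      (\<forall>x\<in>A. exponential F A \<phi>\<^sub>0 x \<longrightarrow> occurrences F A x (\<phi>\<^sub>0 x) \<ge> 3) \<and>
      (\<forall>x\<in>A. \<forall>y\<in>Supp F A \<phi>\<^sub>0 x. appears_in F A y (\<phi>\<^sub>0 x)) \<and>
      (\<forall>x\<in>A. \<forall>j\<ge>1.
         hd (reduced_word F A ((\<phi>\<^sub>0 ^^ j) x)) = hd (reduced_word F A (\<phi>\<^sub>0 x)) \<and>
         last (reduced_word F A ((\<phi>\<^sub>0 ^^ j) x)) = last (reduced_word F A (\<phi>\<^sub>0 x))) \<and>
      (\<forall>x\<in>A. \<forall>j\<ge>1. \<forall>\<Sigma> \<in> stratum F A \<phi>\<^sub>0 ` A. \<Sigma> \<subseteq> Supp F A \<phi>\<^sub>0 x \<longrightarrow>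
         leftmost_in \<Sigma> (reduced_word F A ((\<phi>\<^sub>0 ^^ j) x)) =
           leftmost_in \<Sigma> (reduced_word F A (\<phi>\<^sub>0 x)) \<and>
         rightmost_in \<Sigma> (reduced_word F A ((\<phi>\<^sub>0 ^^ j) x)) =
           rightmost_in \<Sigma> (reduced_word F A (\<phi>\<^sub>0 x))))"
proof -
  interpret free_group F A by fact
  let ?p = "subst_pow (letter_subst \<phi>)"
  have hom: "\<phi> \<in> hom F F" using assms(3) by (simp add: iso_def)
  have rw: "reduced_word F A ((\<phi> ^^ n) x) = positive_word (?p n x)" if "x \<in> A" for n x
    using reduced_word_funpow[OF hom assms(4) that] .
  have closed: "set (?p n x) \<subseteq> A" if "x \<in> A" for n x
    using subst_pow_closed letter_subst_closed[OF hom] that by metis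
  obtain q where q: "q > 0" and orders: "\<And>m x. m > 0 \<Longrightarrow> x \<in> A \<Longrightarrow>
      first_last_orders (?p (q * m) x) = first_last_orders (?p q x)"
    using subst_pow_orders_constant_on_multiples[of A "letter_subst \<phi>", OF assms(2) letter_subst_closed[OF hom]]
    by metis
  note sets = first_last_orders_eqD(1)[OF orders]
  have self: "x \<in> set (?p q x)" if "x \<in> A" for x
  proof -
    obtain j where "j > 0" "x \<in> set (?p j x)"
      using letter_recurrent[OF assms(2-4) \<open>x \<in> A\<close>] by blast
    \<comment> \<open>The letter \<open>x\<close> recurs at stage \<open>j * q\<close>, a positive
      multiple of \<open>q\<close>, where the letters are those of stage \<open>q\<close>.\<close>
    then show ?thesis
      using subst_pow_recurrent[of x "letter_subst \<phi>" j q] sets[of j x] that by (simp add: mult.commute)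
  qed
  \<comment> \<open>The factor 3 serves the count for exponential letters; the other properties hold
    along all positive multiples of \<open>q\<close>.\<close>
  define k where "k = q * 3"
  let ?\<psi> = "\<phi> ^^ k"
  have iter: "reduced_word F A ((?\<psi> ^^ j) x) = positive_word (?p (q * (3 * j)) x)" if "x \<in> A" for j x
    using rw[OF that] by (simp add: k_def funpow_mult ac_simps)
  have once: "reduced_word F A (?\<psi> x) = positive_word (?p (q * 3) x)" if "x \<in> A" for x
    using rw[OF that] by (simp add: k_def)
  have Supp: "Supp F A ?\<psi> x = set (?p q x)" if x: "x \<in> A" for x
  proof
    show "Supp F A ?\<psi> x \<subseteq> set (?p q x)"
    proof
      fix y assume "y \<in> Supp F A ?\<psi> x"
      then obtain j where "y \<in> set (?p (q * (3 * j)) x)"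
        using iter[OF x] by (auto simp: Supp_def appears_in_def)
      \<comment> \<open>Constancy covers positive multiples only. For \<open>j = 0\<close> the
        letter is \<open>x\<close> itself, which \<open>self\<close> handles.\<close>
      then show "y \<in> set (?p q x)"
        using sets[of "3 * j" x] self x by (cases "j = 0") auto
    qed
    show "set (?p q x) \<subseteq> Supp F A ?\<psi> x"
    proof
      fix y assume y: "y \<in> set (?p q x)"
      then have "y \<in> set (?p (q * (3 * 1)) x)" using sets[of 3 x] x by simp
      then have "appears_in F A y ((?\<psi> ^^ 1) x)"
        using iter[OF x, of 1] by (auto simp: appears_in_def)
      then show "y \<in> Supp F A ?\<psi> x" using y closed[OF x] unfolding Supp_def by blast
    qed
  qed
  have appears: "appears_in F A y (?\<psi> x)" if "x \<in> A" "y \<in> set (?p q x)" for x y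
    using once[OF that(1)] sets[of 3 x] that by (auto simp: appears_in_def)
  have same: "first_last_orders (?p (q * (3 * j)) x) = first_last_orders (?p (q * 3) x)"
    if "x \<in> A" "j \<ge> 1" for x j
    using orders[of "3 * j" x] orders[of 3 x] that by simp
  have occ: "3 \<le> occurrences F A x (?\<psi> x)" if x: "x \<in> A" and exp: "exponential F A ?\<psi> x" for x
  proof -
    obtain y where y: "y \<in> A" "y \<noteq> x" "stratum F A ?\<psi> x = stratum F A ?\<psi> y"
      using exp by (auto simp: exponential_def)
    have "x \<in> stratum F A ?\<psi> x" using Supp self x by (simp add: stratum_def)
    then have "x \<in> stratum F A ?\<psi> y" using y(3) by simp
    \<comment> \<open>Equal strata give equal supports, so both \<open>x\<close> and
      \<open>y\<close> occur in the \<open>q\<close>-th iterate of each.\<close>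
    then have "set (?p q x) = set (?p q y)"
      using Supp x y(1) by (simp add: stratum_def)
    then have "3 \<le> count_list (?p (3 * q) x) x"
      using self[OF x] self[OF y(1)] y(2) by (intro count_subst_pow_ge_3[of x y]) auto
    then show ?thesis
      using once[OF x] by (simp add: occurrences_def count_list_positive_word mult.commute)
  qed
  have ends: "hd v = hd w \<and> last v = last w"
    if eq: "first_last_orders v = first_last_orders w" and "v \<noteq> []" for v w :: "'a list"
  proof -
    have "w \<noteq> []" using first_last_orders_eqD(1)[OF eq] \<open>v \<noteq> []\<close> by auto
    \<comment> \<open>End letters are the extreme letters for the predicate that is always true, so
      they too are determined by the two orders.\<close>
    have find_hd: "find (\<lambda>_. True) u = Some (hd u)" if "u \<noteq> []" for u :: "'a list"
      using that by (cases u) auto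
    show ?thesis
      using first_last_orders_eqD(2,3)[OF eq, of "\<lambda>_. True"] \<open>v \<noteq> []\<close> \<open>w \<noteq> []\<close>
      by (simp add: find_hd hd_rev)
  qed
  have nonempty: "?p (q * m) x \<noteq> []" if "x \<in> A" "m > 0" for x m
    using self[OF that(1)] sets[of m x] that by auto
  have hd_last: "hd (reduced_word F A ((?\<psi> ^^ j) x)) = hd (reduced_word F A (?\<psi> x)) \<and>
      last (reduced_word F A ((?\<psi> ^^ j) x)) = last (reduced_word F A (?\<psi> x))"
    if "x \<in> A" "j \<ge> 1" for x j
    using ends[OF same[OF that]] nonempty[OF that(1), of "3 * j"] nonempty[OF that(1), of 3] that
    by (simp add: iter once hd_map last_map)
  have extreme: "leftmost_in S (reduced_word F A ((?\<psi> ^^ j) x)) = leftmost_in S (reduced_word F A (?\<psi> x)) \<and>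
      rightmost_in S (reduced_word F A ((?\<psi> ^^ j) x)) = rightmost_in S (reduced_word F A (?\<psi> x))"
    if "x \<in> A" "j \<ge> 1" for x j S
    using first_last_orders_eqD(2,3)[OF same[OF that]] that
    by (simp add: iter once leftmost_in_positive_word rightmost_in_positive_word)
  have "k > 0" using q by (simp add: k_def)
  then show ?thesis
    unfolding Let_def using appears self occ hd_last extreme Supp
    by (intro exI[of _ k] conjI ballI allI impI) auto
qed

end
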